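(* Let $d\ge1$ and let $SPM$ be the set of symplectic M-matrices in $\mathbb{R}^{2d\times 2d}$. Then $SPM\subsetneq\mathcal{L}_{4}$. Thus any symplectic M-matrix can be factored into no more than $4$ unit triangular symplectic matrices.
   Context: Let $I=I_d$ and $J=\begin{bmatrix} 0 & I_{d} \\ -I_{d} & 0 \end{bmatrix}$. A real $2d\times 2d$ matrix $H$ is symplectic if $H^{T}JH=J$. A matrix $A=(a_{ij})\in\mathbb{R}^{n\times n}$ is an M-matrix if $a_{ij}\le 0$ for all $i\ne j$ and $\mathrm{Re}(\lambda)>0$ for every (complex) eigenvalue $\lambda$ of $A$. The unit triangular symplectic matrices are those of the form $\begin{bmatrix} I & S \\ 0 & I\end{bmatrix}$ (upper) or $\begin{bmatrix} I & 0 \\ S & I\end{bmatrix}$ (lower) with $S\in\mathbb{R}^{d\times d}$ symmetric. For $n\ge1$, $\mathcal{L}_{n}$ is the set of all products $M_n\cdots M_2M_1$ where $M_i=\begin{bmatrix} I & S_i \\ 0 & I\end{bmatrix}$ for $i$ odd and $M_i=\begin{bmatrix} I & 0 \\ S_i & I\end{bmatrix}$ for $i$ even, with $S_1,\dots,S_n\in\mathbb{R}^{d\times d}$ arbitrary symmetric matrices. The symbol $\subsetneq$ denotes proper inclusion. *)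

theory Defs
  imports Complex_Main "Jordan_Normal_Form.Char_Poly"
begin

definition J_mat :: "nat \<Rightarrow> real mat" where
  "J_mat d = four_block_mat (0\<^sub>m d d) (1\<^sub>m d) (- 1\<^sub>m d) (0\<^sub>m d d)"

definition symplectic :: "nat \<Rightarrow> real mat \<Rightarrow> bool" where
  "symplectic d H \<longleftrightarrow>
     H \<in> carrier_mat (2 * d) (2 * d) \<and> transpose_mat H * J_mat d * H = J_mat d"

definition M_matrix :: "real mat \<Rightarrow> bool" where
  "M_matrix A \<longleftrightarrow>
     square_mat A \<and>
     (\<forall>i < dim_row A. \<forall>j < dim_col A. i \<noteq> j \<longrightarrow> A $$ (i, j) \<le> 0) \<and>
     (\<forall>z :: complex. eigenvalue (map_mat complex_of_real A) z \<longrightarrow> Re z > 0)"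

definition SPM :: "nat \<Rightarrow> real mat set" where
  "SPM d = {H. symplectic d H \<and> M_matrix H}"

definition sym_mats :: "nat \<Rightarrow> real mat set" where
  "sym_mats d = {S \<in> carrier_mat d d. transpose_mat S = S}"

definition upper_unit :: "nat \<Rightarrow> real mat \<Rightarrow> real mat" where
  "upper_unit d S = four_block_mat (1\<^sub>m d) S (0\<^sub>m d d) (1\<^sub>m d)"

definition lower_unit :: "nat \<Rightarrow> real mat \<Rightarrow> real mat" where
  "lower_unit d S = four_block_mat (1\<^sub>m d) (0\<^sub>m d d) S (1\<^sub>m d)"

definition unit_triangular_symplectic :: "nat \<Rightarrow> real mat set" where
  "unit_triangular_symplectic d = upper_unit d ` sym_mats d \<union> lower_unit d ` sym_mats d"

definition alt_factor :: "nat \<Rightarrow> (nat \<Rightarrow> real mat) \<Rightarrow> nat \<Rightarrow> real mat" where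
  "alt_factor d S i = (if odd i then upper_unit d (S i) else lower_unit d (S i))"

(* The indices of the factors start at 1, and each new factor is multiplied on the left:
   alt_prod d S n = M_n * ... * M_2 * M_1 with M_i = alt_factor d S i. *)
primrec alt_prod :: "nat \<Rightarrow> (nat \<Rightarrow> real mat) \<Rightarrow> nat \<Rightarrow> real mat" where
  "alt_prod d S 0 = 1\<^sub>m (2 * d)"
| "alt_prod d S (Suc n) = alt_factor d S (Suc n) * alt_prod d S n"

definition L_set :: "nat \<Rightarrow> nat \<Rightarrow> real mat set" where
  "L_set d n = {alt_prod d S n | S. \<forall>i \<in> {1..n}. S i \<in> sym_mats d}"

end

theory Submission
  imports Defs
begin

text \<open>
  An M-matrix H is monotone: H y \<ge> 0 implies y \<ge> 0, so its inverse is entrywise nonnegative.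
  Only the real eigenvalues matter here: H + t I is invertible for all t \<ge> 0, and the solution
  x(t) of (H + t I) x(t) = (1, ..., 1) depends continuously on t, is positive for large t, and can
  never reach the boundary of the positive orthant, because the off-diagonal entries of H are not
  positive. Hence x(0) > 0 and H x(0) > 0, which forces monotonicity.

  If H is also symplectic with blocks A, B, C, D, then the transpose of A is a block of the inverse of H. So A
  is nonnegative, while its off-diagonal entries are nonpositive: A is diagonal, with positive
  diagonal. For symmetric invertible A the factorization is explicit, with
  S1 = K B - I, S2 = I - K, S3 = A and S4 = C K - K + K K, where K is the inverse of A.
\<close>

section \<open>Matrices with nonpositive off-diagonal entries and monotonicity\<close>

lemma mult_mat_vec_index_sum:
  assumes "A \<in> carrier_mat m n" "v \<in> carrier_vec n" "i < m"
  shows "(A *\<^sub>v v) $ i = (\<Sum>j = 0..<n. A $$ (i, j) * v $ j)"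
  using assms by (simp add: scalar_prod_def)

text \<open>The diagonal entry, whose sign is unknown, meets the coordinate
  \<open>y $ i = 0\<close>; every other term of the row sum is a nonpositive entry times a
  nonnegative coordinate.\<close>

lemma Z_matrix_mult_nonpos_at_zero:
  fixes A :: "real mat"
  assumes A: "A \<in> carrier_mat n n" and y: "y \<in> carrier_vec n"
    and Z: "\<And>i j. i < n \<Longrightarrow> j < n \<Longrightarrow> i \<noteq> j \<Longrightarrow> A $$ (i, j) \<le> 0"
    and nonneg: "\<And>i. i < n \<Longrightarrow> y $ i \<ge> 0"
    and i: "i < n" and zero: "y $ i = 0"
  shows "(A *\<^sub>v y) $ i \<le> 0"
proof -
  have "(A *\<^sub>v y) $ i = (\<Sum>j = 0..<n. A $$ (i, j) * y $ j)"
    by (rule mult_mat_vec_index_sum[OF A y i])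
  also have "\<dots> \<le> 0"
  proof (rule sum_nonpos)
    fix j assume "j \<in> {0..<n}"
    then show "A $$ (i, j) * y $ j \<le> 0"
      using Z[OF i, of j] nonneg[of j] zero by (cases "i = j") (auto intro: mult_nonpos_nonneg)
  qed
  finally show ?thesis .
qed

text \<open>If \<open>y\<close> had a negative coordinate, shifting it by a negative multiple
  \<open>c\<close> of \<open>x\<close> would give a nonnegative vector \<open>w\<close> vanishing at
  some \<open>k\<close>. Row \<open>k\<close> of \<open>A *\<^sub>v w\<close> is then nonpositive,
  yet it equals \<open>(A *\<^sub>v y) $ k - c * (A *\<^sub>v x) $ k\<close>, which is
  positive.\<close>

lemma Z_matrix_monotone:
  fixes A :: "real mat"
  assumes A: "A \<in> carrier_mat n n" and x: "x \<in> carrier_vec n" and y: "y \<in> carrier_vec n"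
    and Z: "\<And>i j. i < n \<Longrightarrow> j < n \<Longrightarrow> i \<noteq> j \<Longrightarrow> A $$ (i, j) \<le> 0"
    and xpos: "\<And>i. i < n \<Longrightarrow> x $ i > 0" and Axpos: "\<And>i. i < n \<Longrightarrow> (A *\<^sub>v x) $ i > 0"
    and Ay: "\<And>i. i < n \<Longrightarrow> (A *\<^sub>v y) $ i \<ge> 0"
    and i: "i < n"
  shows "y $ i \<ge> 0"
proof (rule ccontr)
  assume neg: "\<not> y $ i \<ge> 0"
  define r where "r j = y $ j / x $ j" for j
  \<comment> \<open>The minimal ratio is the largest scalar for which
    \<open>y - c \<cdot>\<^sub>v x\<close> stays nonnegative; the minimizing index is where that
    vector vanishes.\<close>
  define c where "c = Min (r ` {..<n})"
  have cle: "c \<le> r j" if "j < n" for j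
    using that unfolding c_def by (intro Min_le) auto
  have "c \<in> r ` {..<n}"
    unfolding c_def using i by (intro Min_in) auto
  then obtain k where k: "k < n" "c = r k" by auto
  have "r i < 0" using neg xpos[OF i] by (simp add: r_def divide_neg_pos)
  then have c: "c < 0" using cle[OF i] by linarith
  define w where "w = y - c \<cdot>\<^sub>v x"
  have w: "w \<in> carrier_vec n" using x y by (simp add: w_def)
  have "(A *\<^sub>v w) $ k \<le> 0"
  proof (rule Z_matrix_mult_nonpos_at_zero[OF A w Z _ k(1)])
    show "w $ j \<ge> 0" if "j < n" for j
      using cle[OF that] xpos[OF that] x y that
      by (simp add: w_def r_def pos_le_divide_eq)
    show "w $ k = 0" using k xpos[of k] x y by (simp add: w_def r_def)
  qed
  moreover have "A *\<^sub>v w = A *\<^sub>v y - c \<cdot>\<^sub>v (A *\<^sub>v x)"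
    unfolding w_def using A x y by (simp add: mult_minus_distrib_mat_vec mult_mat_vec)
  ultimately have "(A *\<^sub>v y) $ k - c * (A *\<^sub>v x) $ k \<le> 0"
    using A x y k(1) by simp
  then show False
    using mult_neg_pos[OF c Axpos[OF k(1)]] Ay[OF k(1)] by linarith
qed

section \<open>A positive vector with positive image, by continuity\<close>

lemma continuous_on_Min_image:
  fixes f :: "'i \<Rightarrow> 'a::topological_space \<Rightarrow> real"
  assumes "finite I" "I \<noteq> {}" "\<And>i. i \<in> I \<Longrightarrow> continuous_on S (f i)"
  shows "continuous_on S (\<lambda>t. Min ((\<lambda>i. f i t) ` I))"
  using assms
proof (induction I rule: finite_ne_induct)
  case (insert i I)
  then show ?case by (simp add: continuous_on_min)
qed simp

text \<open>By the Leibniz formula the determinant is a finite sum of signed products of entries; a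
  permutation keeps the column indices in range.\<close>

lemma continuous_on_det:
  fixes M :: "'a::topological_space \<Rightarrow> real mat"
  assumes "\<And>t. M t \<in> carrier_mat n n"
    and "\<And>i j. i < n \<Longrightarrow> j < n \<Longrightarrow> continuous_on S (\<lambda>t. M t $$ (i, j))"
  shows "continuous_on S (\<lambda>t. det (M t))"
proof -
  have "i < n \<Longrightarrow> p permutes {0..<n} \<Longrightarrow> p i < n" for i p
    using permutes_in_image[of p "{0..<n}" i] by simp
  then show ?thesis
    unfolding det_def'[OF assms(1)] by (intro continuous_intros) (auto intro: assms(2))
qed

lemma smult_mat_mult_mat_vec:
  fixes A :: "'a::comm_ring mat"
  assumes "A \<in> carrier_mat m n" "v \<in> carrier_vec n"
  shows "(c \<cdot>\<^sub>m A) *\<^sub>v v = c \<cdot>\<^sub>v (A *\<^sub>v v)"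
  using assms by (intro eq_vecI) auto

lemma Z_matrix_positive_vector:
  fixes A :: "real mat"
  assumes A: "A \<in> carrier_mat n n"
    and Z: "\<And>i j. i < n \<Longrightarrow> j < n \<Longrightarrow> i \<noteq> j \<Longrightarrow> A $$ (i, j) \<le> 0"
    and det: "\<And>t. t \<ge> 0 \<Longrightarrow> det (A + t \<cdot>\<^sub>m 1\<^sub>m n) \<noteq> 0"
  obtains x where "x \<in> carrier_vec n" "\<And>i. i < n \<Longrightarrow> x $ i > 0" "\<And>i. i < n \<Longrightarrow> (A *\<^sub>v x) $ i > 0"
proof (cases "n = 0")
  \<comment> \<open>Dimension 0 is split off because the minimum over the coordinates taken below
    requires a nonempty index set.\<close>
  case True
  then show ?thesis by (intro that[of "0\<^sub>v n"]) auto
next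
  case False
  define At where "At t = A + t \<cdot>\<^sub>m 1\<^sub>m n" for t
  define e :: "real vec" where "e = vec n (\<lambda>_. 1)"
  \<comment> \<open>The inverse is written through the adjugate, which makes \<open>x\<close> a
    total function of \<open>t\<close>. It solves the linear system wherever the determinant is
    nonzero, in particular for all \<open>t \<ge> 0\<close>.\<close>
  define x where "x t = (1 / det (At t)) \<cdot>\<^sub>v (adj_mat (At t) *\<^sub>v e)" for t
  have At: "At t \<in> carrier_mat n n" for t using A by (simp add: At_def)
  have e: "e \<in> carrier_vec n" by (simp add: e_def)
  have x: "x t \<in> carrier_vec n" for t
    using mult_mat_vec_carrier[OF adj_mat(1)[OF At] e] by (simp add: x_def)
  have AtZ: "At t $$ (i, j) \<le> 0" if "i < n" "j < n" "i \<noteq> j" for t i j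
    using Z[OF that] A that by (simp add: At_def)
  have Atx: "At t *\<^sub>v x t = e" if "t \<ge> 0" for t
  proof -
    have "At t *\<^sub>v x t = (1 / det (At t)) \<cdot>\<^sub>v ((At t * adj_mat (At t)) *\<^sub>v e)"
      using At[of t] adj_mat(1)[OF At[of t]] e by (simp add: x_def mult_mat_vec)
    also have "\<dots> = (1 / det (At t)) \<cdot>\<^sub>v (det (At t) \<cdot>\<^sub>v e)"
      using e by (simp add: adj_mat(2)[OF At] smult_mat_mult_mat_vec[of _ n n])
    finally show ?thesis using det[OF that] by (simp add: At_def smult_smult_assoc)
  qed
  \<comment> \<open>A nonnegative solution with a zero coordinate \<open>i\<close> would have a
    nonpositive entry \<open>i\<close> in its image, but that entry is 1.\<close>
  have strict: "x t $ i > 0" if t: "t \<ge> 0" and nonneg: "\<And>j. j < n \<Longrightarrow> x t $ j \<ge> 0" and i: "i < n" for t i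
  proof (rule ccontr)
    assume "\<not> x t $ i > 0"
    with nonneg[OF i] have "x t $ i = 0" by simp
    from Z_matrix_mult_nonpos_at_zero[OF At[of t] x[of t] AtZ nonneg i this]
    show False using Atx[OF t] i by (simp add: e_def)
  qed
  \<comment> \<open>This \<open>T\<close> exceeds every
    \<open>\<bar>(A *\<^sub>v e) $ k\<bar>\<close>, so \<open>At T\<close> maps the positive vector
    \<open>e\<close> to a positive vector. Hence \<open>At T\<close> is monotone, and
    \<open>x T\<close> is nonnegative because its image is \<open>e\<close>.\<close>
  define T where "T = (\<Sum>i<n. \<bar>(A *\<^sub>v e) $ i\<bar>) + 1"
  have T: "T \<ge> 0" unfolding T_def by (intro add_nonneg_nonneg sum_nonneg) auto
  have xT: "x T $ i > 0" if i: "i < n" for i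
  proof (rule strict[OF T _ i])
    fix j assume j: "j < n"
    show "x T $ j \<ge> 0"
    proof (rule Z_matrix_monotone[OF At e x AtZ _ _ _ j])
      show "(At T *\<^sub>v e) $ k > 0" if k: "k < n" for k
      proof -
        have "\<bar>(A *\<^sub>v e) $ k\<bar> \<le> (\<Sum>i<n. \<bar>(A *\<^sub>v e) $ i\<bar>)"
          using k by (intro member_le_sum) auto
        moreover have "At T *\<^sub>v e = A *\<^sub>v e + T \<cdot>\<^sub>v e"
          using A e by (simp add: At_def add_mult_distrib_mat_vec[of _ n n] smult_mat_mult_mat_vec[of _ n n])
        ultimately show ?thesis using k A e by (simp add: T_def e_def)
      qed
    qed (simp_all add: e_def Atx[OF T])
  qed
  \<comment> \<open>A zero of f would be a nonnegative solution with a vanishing coordinate, which strict excludes.\<close>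
  define f where "f t = Min ((\<lambda>i. x t $ i) ` {..<n})" for t
  have "continuous_on {0..T} f"
    unfolding f_def
  proof (rule continuous_on_Min_image)
    fix i assume "i \<in> {..<n}"
    then have i: "i < n" by simp
    \<comment> \<open>Cramer's rule reduces continuity of the coordinate to that of two
      determinants, whose entries are affine in \<open>t\<close>.\<close>
    have "x t $ i = det (replace_col (At t) e i) / det (At t)" if "t \<ge> 0" for t
      using cramer_lemma_mat[OF At x i, of t t] Atx[OF that] det[OF that] by (simp add: At_def)
    moreover have "continuous_on {0..T} (\<lambda>t. det (replace_col (At t) e i) / det (At t))"
    proof (intro continuous_on_divide continuous_on_det)
      show "At t \<in> carrier_mat n n" for t by (rule At)
      show "replace_col (At t) e i \<in> carrier_mat n n" for t using At[of t] by (auto simp: replace_col_def)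
      show entry: "continuous_on {0..T} (\<lambda>t. At t $$ (j, k))" if "j < n" "k < n" for j k
      proof -
        have "(\<lambda>t. At t $$ (j, k)) = (\<lambda>t. A $$ (j, k) + t * (if j = k then 1 else 0))"
          using A that by (auto simp: At_def)
        then show ?thesis by (simp only:) (intro continuous_intros)
      qed
      show "continuous_on {0..T} (\<lambda>t. replace_col (At t) e i $$ (j, k))" if "j < n" "k < n" for j k
      proof -
        have eq: "replace_col (At t) e i $$ (j, k) = (if k = i then e $ j else At t $$ (j, k))" for t
          using carrier_matD[OF At[of t]] that by (auto simp: replace_col_def)
        show ?thesis unfolding eq using entry[OF that] by (cases "k = i") simp_all
      qed
      show "\<forall>t\<in>{0..T}. det (At t) \<noteq> 0" using det by (simp add: At_def)
    qed
    ultimately show "continuous_on {0..T} (\<lambda>t. x t $ i)"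
      by (subst continuous_on_cong[OF refl]) simp_all
  qed (use False in auto)
  moreover have "f T > 0" unfolding f_def using xT False by (subst Min_gr_iff) auto
  moreover have "f t \<noteq> 0" if "t \<ge> 0" for t
  proof
    assume f0: "f t = 0"
    have "x t $ j \<ge> 0" if "j < n" for j
      using that unfolding f0[symmetric] f_def by (intro Min_le) auto
    from strict[OF \<open>t \<ge> 0\<close> this] have "f t > 0"
      unfolding f_def using False by (subst Min_gr_iff) auto
    with f0 show False by simp
  qed
  \<comment> \<open>If \<open>f 0\<close> were nonpositive, the intermediate value theorem would
    produce a zero of \<open>f\<close> in the interval from 0 to \<open>T\<close>.\<close>
  ultimately have "f 0 > 0" using IVT'[of f 0 0 T] T by fastforce
  then have "x 0 $ i > 0" if "i < n" for i
    using that False unfolding f_def by (subst (asm) Min_gr_iff) auto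
  moreover have "At 0 = A" using A by (auto simp: At_def)
  ultimately show ?thesis using Atx[of 0] by (intro that[OF x[of 0]]) (auto simp: e_def)
qed

text \<open>A singular \<open>A + t I\<close> with \<open>t \<ge> 0\<close> would make
  \<open>- t\<close> a real eigenvalue of \<open>A\<close>. It remains an eigenvalue over the
  complex numbers, against the condition on real parts.\<close>

lemma M_matrix_positive_vector:
  assumes A: "A \<in> carrier_mat n n" and M: "M_matrix A"
  obtains x where "x \<in> carrier_vec n" "\<And>i. i < n \<Longrightarrow> x $ i > 0" "\<And>i. i < n \<Longrightarrow> (A *\<^sub>v x) $ i > 0"
proof (rule Z_matrix_positive_vector[OF A])
  show "A $$ (i, j) \<le> 0" if "i < n" "j < n" "i \<noteq> j" for i j
    using M A that by (simp add: M_matrix_def)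
  show "det (A + t \<cdot>\<^sub>m 1\<^sub>m n) \<noteq> 0" if t: "t \<ge> 0" for t
  proof
    assume d: "det (A + t \<cdot>\<^sub>m 1\<^sub>m n) = 0"
    have "char_matrix A (- t) = A + t \<cdot>\<^sub>m 1\<^sub>m n" using A by (simp add: char_matrix_def)
    with d have "eigenvalue A (- t)" by (simp add: eigenvalue_det[OF A])
    then have "eigenvalue (map_mat complex_of_real A) (complex_of_real (- t))"
      by (rule of_real_hom.eigenvalue_hom[OF A])
    then have "Re (complex_of_real (- t)) > 0" using M unfolding M_matrix_def by blast
    with t show False by simp
  qed
qed (use that in auto)

section \<open>Block relations and the inverse of a symplectic matrix\<close>

lemma four_block_mat_eqD:
  assumes eq: "four_block_mat A B C D = four_block_mat A' B' C' D'"
    and "A \<in> carrier_mat m n" "A' \<in> carrier_mat m n" "B \<in> carrier_mat m k" "B' \<in> carrier_mat m k"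
    and "C \<in> carrier_mat l n" "C' \<in> carrier_mat l n" "D \<in> carrier_mat l k" "D' \<in> carrier_mat l k"
  shows "A = A'" "B = B'" "C = C'" "D = D'"
proof -
  have eq: "four_block_mat A B C D $$ p = four_block_mat A' B' C' D' $$ p" for p using eq by simp
  show "A = A'"
  proof (rule eq_matI)
    show "A $$ (i, j) = A' $$ (i, j)" if "i < dim_row A'" "j < dim_col A'" for i j
      using eq[of "(i, j)"] that assms(2-) by simp
  qed (use assms in auto)
  show "B = B'"
  proof (rule eq_matI)
    show "B $$ (i, j) = B' $$ (i, j)" if "i < dim_row B'" "j < dim_col B'" for i j
      using eq[of "(i, n + j)"] that assms(2-) by simp
  qed (use assms in auto)
  show "C = C'"
  proof (rule eq_matI)
    show "C $$ (i, j) = C' $$ (i, j)" if "i < dim_row C'" "j < dim_col C'" for i j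
      using eq[of "(m + i, j)"] that assms(2-) by simp
  qed (use assms in auto)
  show "D = D'"
  proof (rule eq_matI)
    show "D $$ (i, j) = D' $$ (i, j)" if "i < dim_row D'" "j < dim_col D'" for i j
      using eq[of "(m + i, n + j)"] that assms(2-) by simp
  qed (use assms in auto)
qed

text \<open>These are the four blocks of the defining equation multiplied out. The lower left block
  is negated so that the first three relations and the last one are exactly the blocks of the left
  inverse identity.\<close>

lemma symplectic_block_relations:
  assumes blocks: "A \<in> carrier_mat d d" "B \<in> carrier_mat d d" "C \<in> carrier_mat d d" "D \<in> carrier_mat d d"
    and H: "symplectic d (four_block_mat A B C D)"
  shows "A\<^sup>T * C = C\<^sup>T * A" "A\<^sup>T * D - C\<^sup>T * B = 1\<^sub>m d" "D\<^sup>T * A - B\<^sup>T * C = 1\<^sub>m d" "B\<^sup>T * D = D\<^sup>T * B"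
proof -
  have cong: "X = Y" if "X - Y = 0\<^sub>m d d" "X \<in> carrier_mat d d" "Y \<in> carrier_mat d d" for X Y :: "real mat"
  proof (rule eq_matI)
    show "X $$ (i, j) = Y $$ (i, j)" if "i < dim_row Y" "j < dim_col Y" for i j
      using arg_cong[OF \<open>X - Y = 0\<^sub>m d d\<close>, of "\<lambda>M. M $$ (i, j)"] that \<open>Y \<in> carrier_mat d d\<close> by simp
  qed (use that in auto)
  have HT: "(four_block_mat A B C D)\<^sup>T = four_block_mat (A\<^sup>T) (C\<^sup>T) (B\<^sup>T) (D\<^sup>T)"
    by (rule transpose_four_block_mat) (use blocks in auto)
  have HTJ: "four_block_mat (A\<^sup>T) (C\<^sup>T) (B\<^sup>T) (D\<^sup>T) * J_mat d = four_block_mat (- (C\<^sup>T)) (A\<^sup>T) (- (D\<^sup>T)) (B\<^sup>T)"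
    unfolding J_mat_def using blocks by (subst mult_four_block_mat[of _ d d _ d _ d _ _ d _ d]) auto
  have "four_block_mat (A\<^sup>T * C - C\<^sup>T * A) (A\<^sup>T * D - C\<^sup>T * B) (B\<^sup>T * C - D\<^sup>T * A) (B\<^sup>T * D - D\<^sup>T * B)
      = four_block_mat (- (C\<^sup>T)) (A\<^sup>T) (- (D\<^sup>T)) (B\<^sup>T) * four_block_mat A B C D"
    using blocks by (subst mult_four_block_mat[of _ d d _ d _ d _ _ d _ d])
      (auto intro!: cong_four_block_mat eq_matI)
  also have "\<dots> = four_block_mat (0\<^sub>m d d) (1\<^sub>m d) (- 1\<^sub>m d) (0\<^sub>m d d)"
    using H unfolding symplectic_def HT HTJ by (simp add: J_mat_def)
  finally have eq: "four_block_mat (A\<^sup>T * C - C\<^sup>T * A) (A\<^sup>T * D - C\<^sup>T * B) (B\<^sup>T * C - D\<^sup>T * A) (B\<^sup>T * D - D\<^sup>T * B)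
      = four_block_mat (0\<^sub>m d d) (1\<^sub>m d) (- 1\<^sub>m d) (0\<^sub>m d d)" .
  have diff: "M\<^sup>T * N - M'\<^sup>T * N' \<in> carrier_mat d d" if "M' \<in> carrier_mat d d" "N' \<in> carrier_mat d d"
    for M N M' N' :: "real mat"
    using that by (intro minus_carrier_mat mult_carrier_mat[of _ d d]) simp_all
  note eqs = four_block_mat_eqD[OF eq diff zero_carrier_mat diff one_carrier_mat
      diff uminus_carrier_mat[OF one_carrier_mat] diff zero_carrier_mat, OF blocks(3,1,3,2,4,1,4,2)]
  show "A\<^sup>T * C = C\<^sup>T * A" by (rule cong[OF eqs(1)]) (use blocks in auto)
  show "A\<^sup>T * D - C\<^sup>T * B = 1\<^sub>m d" by (rule eqs(2))
  show "B\<^sup>T * D = D\<^sup>T * B" by (rule cong[OF eqs(4)]) (use blocks in auto)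
  have "D\<^sup>T * A - B\<^sup>T * C = - (B\<^sup>T * C - D\<^sup>T * A)" using blocks by (intro eq_matI) auto
  also have "B\<^sup>T * C - D\<^sup>T * A = - 1\<^sub>m d" by (rule eqs(3))
  finally show "D\<^sup>T * A - B\<^sup>T * C = 1\<^sub>m d" by (simp add: uminus_uminus_mat)
qed

text \<open>The second factor is \<open>- J H^T J\<close> written in blocks. The block relations
  show that it is a left inverse, and for square matrices a left inverse is also a right
  inverse.\<close>

lemma symplectic_right_inverse:
  assumes blocks: "A \<in> carrier_mat d d" "B \<in> carrier_mat d d" "C \<in> carrier_mat d d" "D \<in> carrier_mat d d"
    and H: "symplectic d (four_block_mat A B C D)"
  shows "four_block_mat A B C D * four_block_mat (D\<^sup>T) (- (B\<^sup>T)) (- (C\<^sup>T)) (A\<^sup>T) = 1\<^sub>m (d + d)"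
proof (rule mat_mult_left_right_inverse)
  note rels = symplectic_block_relations[OF blocks H]
  have "four_block_mat (D\<^sup>T) (- (B\<^sup>T)) (- (C\<^sup>T)) (A\<^sup>T) * four_block_mat A B C D
      = four_block_mat (D\<^sup>T * A - B\<^sup>T * C) (D\<^sup>T * B - B\<^sup>T * D) (A\<^sup>T * C - C\<^sup>T * A) (A\<^sup>T * D - C\<^sup>T * B)"
    using blocks by (subst mult_four_block_mat[of _ d d _ d _ d _ _ d _ d])
      (auto intro!: cong_four_block_mat eq_matI)
  also have "\<dots> = four_block_mat (1\<^sub>m d) (0\<^sub>m d d) (0\<^sub>m d d) (1\<^sub>m d)"
    using blocks unfolding rels by (intro cong_four_block_mat) auto
  finally show "four_block_mat (D\<^sup>T) (- (B\<^sup>T)) (- (C\<^sup>T)) (A\<^sup>T) * four_block_mat A B C D = 1\<^sub>m (d + d)" by simp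
qed (use blocks in auto)

section \<open>Explicit factorization for a symmetric invertible upper left block\<close>

text \<open>Each factor on the left adds a multiple of one block row to the other. The result is
  left unexpanded so that its upper blocks reappear verbatim in the lower row, where they can be
  replaced by \<open>A\<close> and \<open>B\<close>.\<close>

lemma lower_upper_lower_upper_eq:
  assumes "S1 \<in> carrier_mat d d" "S2 \<in> carrier_mat d d" "S3 \<in> carrier_mat d d" "S4 \<in> carrier_mat d d"
  shows "lower_unit d S4 * (upper_unit d S3 * (lower_unit d S2 * upper_unit d S1))
     = four_block_mat (1\<^sub>m d + S3 * S2) (S1 + S3 * (S2 * S1 + 1\<^sub>m d))
         (S4 * (1\<^sub>m d + S3 * S2) + S2) (S4 * (S1 + S3 * (S2 * S1 + 1\<^sub>m d)) + (S2 * S1 + 1\<^sub>m d))"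
proof -
  have "lower_unit d S2 * upper_unit d S1 = four_block_mat (1\<^sub>m d) S1 S2 (S2 * S1 + 1\<^sub>m d)"
    unfolding lower_unit_def upper_unit_def
    using assms by (subst mult_four_block_mat[of _ d d _ d _ d _ _ d _ d]) auto
  moreover have "upper_unit d S3 * \<dots> = four_block_mat (1\<^sub>m d + S3 * S2) (S1 + S3 * (S2 * S1 + 1\<^sub>m d)) S2 (S2 * S1 + 1\<^sub>m d)"
    unfolding upper_unit_def
    using assms by (subst mult_four_block_mat[of _ d d _ d _ d _ _ d _ d]) auto
  moreover have "lower_unit d S4 * \<dots> = four_block_mat (1\<^sub>m d + S3 * S2) (S1 + S3 * (S2 * S1 + 1\<^sub>m d))
         (S4 * (1\<^sub>m d + S3 * S2) + S2) (S4 * (S1 + S3 * (S2 * S1 + 1\<^sub>m d)) + (S2 * S1 + 1\<^sub>m d))"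
    unfolding lower_unit_def
    using assms by (subst mult_four_block_mat[of _ d d _ d _ d _ _ d _ d]) auto
  ultimately show ?thesis by simp
qed

text \<open>Symplecticity enters twice: it makes \<open>K * B\<close> and \<open>C * K\<close>
  symmetric, hence also the factors, and it fixes the Schur complement \<open>D - C * K * B\<close>
  to be \<open>K\<close>, which settles the lower right block.\<close>

lemma symplectic_factorization:
  assumes blocks: "A \<in> carrier_mat d d" "B \<in> carrier_mat d d" "C \<in> carrier_mat d d" "D \<in> carrier_mat d d"
    and H: "symplectic d (four_block_mat A B C D)"
    and K: "K \<in> carrier_mat d d" and AK: "A * K = 1\<^sub>m d"
    and A: "A\<^sup>T = A"
  obtains S1 S2 S3 S4 where "S1 \<in> sym_mats d" "S2 \<in> sym_mats d" "S3 \<in> sym_mats d" "S4 \<in> sym_mats d"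
    "four_block_mat A B C D = lower_unit d S4 * (upper_unit d S3 * (lower_unit d S2 * upper_unit d S1))"
proof -
  note [simp] = blocks K left_mult_one_mat[of _ d d] right_mult_one_mat[of _ d d]
    mult_carrier_mat[of _ d d _ d] minus_carrier_mat
    blocks[THEN carrier_matD(1)] blocks[THEN carrier_matD(2)] K[THEN carrier_matD(1)] K[THEN carrier_matD(2)]
  note rels = symplectic_block_relations[OF blocks H, unfolded A]
  have KA: "K * A = 1\<^sub>m d" by (rule mat_mult_left_right_inverse[OF blocks(1) K AK])
  \<comment> \<open>Transposing \<open>A * K = 1\<close> shows that the transpose of
    \<open>K\<close> is a left inverse of the symmetric \<open>A\<close>, so it agrees with
    \<open>K\<close>.\<close>
  have KT: "K\<^sup>T = K"
  proof -
    have "K\<^sup>T = K\<^sup>T * (A * K)" by (simp add: AK)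
    also have "\<dots> = (K\<^sup>T * A) * K" by (simp add: assoc_mult_mat[of _ d d _ d _ d])
    also have "K\<^sup>T * A = 1\<^sub>m d" using arg_cong[OF AK, of transpose_mat] A by (simp add: transpose_mult[of _ d d _ d])
    finally show ?thesis by simp
  qed
  define P where "P = K * B"
  define Q where "Q = C * K"
  have PQ [simp]: "P \<in> carrier_mat d d" "Q \<in> carrier_mat d d" by (simp_all add: P_def Q_def)
  note [simp] = PQ[THEN carrier_matD(1)] PQ[THEN carrier_matD(2)]
  have cancel: "A * (K * X) = X" "K * (A * X) = X" if "X \<in> carrier_mat d d" for X
    using that by (simp_all add: AK KA flip: assoc_mult_mat[of _ d d _ d _ d])
  note assoc = assoc_mult_mat[of _ d d _ d _ d]
  \<comment> \<open>This is the companion relation with the transpose on the right, read off the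
    upper right block of the right inverse identity. Multiplying it by \<open>K\<close> on both
    sides gives the symmetry of \<open>P\<close>.\<close>
  have AB: "A * B\<^sup>T = B * A"
  proof -
    have "four_block_mat (A * D\<^sup>T + B * - (C\<^sup>T)) (A * - (B\<^sup>T) + B * A) (C * D\<^sup>T + D * - (C\<^sup>T)) (C * - (B\<^sup>T) + D * A)
        = four_block_mat A B C D * four_block_mat (D\<^sup>T) (- (B\<^sup>T)) (- (C\<^sup>T)) (A\<^sup>T)"
      unfolding A by (subst mult_four_block_mat[of _ d d _ d _ d _ _ d _ d]) simp_all
    also have "\<dots> = four_block_mat (1\<^sub>m d) (0\<^sub>m d d) (0\<^sub>m d d) (1\<^sub>m d)"
      by (simp add: symplectic_right_inverse[OF blocks H])
    finally have zero: "A * - (B\<^sup>T) + B * A = 0\<^sub>m d d"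
      by (rule four_block_mat_eqD(2)[of _ _ _ _ _ _ _ _ d d d d]) simp_all
    show ?thesis
    proof (rule eq_matI)
      show "(A * B\<^sup>T) $$ (i, j) = (B * A) $$ (i, j)" if "i < dim_row (B * A)" "j < dim_col (B * A)" for i j
        using arg_cong[OF zero, of "\<lambda>M. M $$ (i, j)"] that by (simp del: index_mult_mat(1))
    qed simp_all
  qed
  have PT: "P\<^sup>T = P"
  proof -
    have "B\<^sup>T * K = K * (A * B\<^sup>T) * K" by (simp add: cancel)
    also have "\<dots> = K * B" unfolding AB by (simp add: assoc AK)
    finally show ?thesis by (simp add: P_def transpose_mult[of _ d d _ d] KT)
  qed
  have QT: "Q = K * C\<^sup>T"
  proof -
    have "C * K = K * (A * C) * K" by (simp add: cancel)
    also have "\<dots> = K * C\<^sup>T" unfolding rels by (simp add: assoc AK)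
    finally show ?thesis by (simp add: Q_def)
  qed
  \<comment> \<open>The second block relation determines \<open>A * D\<close>; multiplying by
    \<open>K\<close> and using \<open>Q = K * C\<^sup>T\<close> expresses \<open>D\<close> through
    the other blocks.\<close>
  have "D = K * (A * D)" by (simp add: cancel)
  also have "A * D = 1\<^sub>m d + C\<^sup>T * B"
  proof (rule eq_matI)
    show "(A * D) $$ (i, j) = (1\<^sub>m d + C\<^sup>T * B) $$ (i, j)"
      if "i < dim_row (1\<^sub>m d + C\<^sup>T * B)" "j < dim_col (1\<^sub>m d + C\<^sup>T * B)" for i j
      using arg_cong[OF rels(2), of "\<lambda>M. M $$ (i, j)"] that by (simp del: index_mult_mat(1))
  qed simp_all
  also have "K * \<dots> = K + Q * B" by (simp add: mult_add_distrib_mat[of _ d d _ d] QT assoc)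
  finally have D: "D = K + Q * B" .
  have prods: "A * P = B" "Q * A = C" "K * B = P" by (simp_all add: P_def Q_def cancel assoc KA)
  \<comment> \<open>With third factor \<open>A\<close>, the upper left equation
    \<open>1 + A * S2 = A\<close> forces \<open>S2\<close>. The upper right one then reads
    \<open>A * S1 + A = B\<close>, and the lower left one \<open>S4 * A + S2 = C\<close>; solving
    them gives \<open>S1\<close> and \<open>S4\<close>.\<close>
  define S1 where "S1 = P - 1\<^sub>m d"
  define S2 where "S2 = 1\<^sub>m d - K"
  define S4 where "S4 = Q - K + K * K"
  have sym: "S1 \<in> sym_mats d" "S2 \<in> sym_mats d" "A \<in> sym_mats d" "S4 \<in> sym_mats d"
  proof -
    have "Q\<^sup>T = Q" by (subst (1) QT, simp add: Q_def transpose_mult[of _ d d _ d] KT)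
    then show "S1 \<in> sym_mats d" "S2 \<in> sym_mats d" "A \<in> sym_mats d" "S4 \<in> sym_mats d"
      using PT KT A by (simp_all add: sym_mats_def S1_def S2_def S4_def transpose_minus[of _ d d]
        transpose_add[of _ d d] transpose_mult[of _ d d _ d] transpose_one)
  qed
  have carr [simp]: "S1 \<in> carrier_mat d d" "S2 \<in> carrier_mat d d" "S4 \<in> carrier_mat d d"
    using sym by (simp_all add: sym_mats_def)
  note [simp] = carr[THEN carrier_matD(1)] carr[THEN carrier_matD(2)]
  note expand = mult_minus_distrib_mat[of _ d d _ d] minus_mult_distrib_mat[of _ d d _ _ d]
    mult_add_distrib_mat[of _ d d _ d] add_mult_distrib_mat[of _ d d _ _ d]
  have E: "S2 * S1 + 1\<^sub>m d = P - K * P + K"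
    by (rule eq_matI) (simp_all add: S1_def S2_def expand del: index_mult_mat(1))
  have "1\<^sub>m d + A * S2 = A"
    by (rule eq_matI) (simp_all add: S2_def expand AK del: index_mult_mat(1))
  moreover have "S1 + A * (S2 * S1 + 1\<^sub>m d) = B"
    unfolding E by (rule eq_matI) (simp_all add: S1_def expand AK prods cancel del: index_mult_mat(1))
  moreover have "S4 * A + S2 = C"
    by (rule eq_matI) (simp_all add: S4_def S2_def expand KA prods assoc del: index_mult_mat(1))
  \<comment> \<open>The terms in \<open>P\<close> and in \<open>K * P\<close> cancel, leaving
    \<open>K + Q * B\<close>.\<close>
  moreover have "S4 * B + (S2 * S1 + 1\<^sub>m d) = D"
    unfolding E D by (rule eq_matI) (simp_all add: S4_def expand prods assoc del: index_mult_mat(1))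
  ultimately show thesis
    using that[OF sym] lower_upper_lower_upper_eq[of S1 d S2 A S4] by simp
qed

section \<open>The upper left block of a symplectic M-matrix\<close>

lemma SPM_upper_left_block:
  assumes blocks: "A \<in> carrier_mat d d" "B \<in> carrier_mat d d" "C \<in> carrier_mat d d" "D \<in> carrier_mat d d"
    and H: "four_block_mat A B C D \<in> SPM d"
  shows "\<And>i. i < d \<Longrightarrow> A $$ (i, i) > 0" "\<And>i j. i < d \<Longrightarrow> j < d \<Longrightarrow> i \<noteq> j \<Longrightarrow> A $$ (i, j) = 0"
proof -
  let ?H = "four_block_mat A B C D"
  let ?N = "four_block_mat (D\<^sup>T) (- (B\<^sup>T)) (- (C\<^sup>T)) (A\<^sup>T)"
  have symp: "symplectic d ?H" and M: "M_matrix ?H" using H by (simp_all add: SPM_def)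
  have Hc: "?H \<in> carrier_mat (d + d) (d + d)" and Nc: "?N \<in> carrier_mat (d + d) (d + d)"
    using blocks by auto
  have Z: "?H $$ (i, j) \<le> 0" if "i < d + d" "j < d + d" "i \<noteq> j" for i j
    using M Hc that by (auto simp: M_matrix_def simp del: index_mat_four_block)
  have offdiag: "A $$ (i, j) \<le> 0" if "i < d" "j < d" "i \<noteq> j" for i j
    using Z[of i j] that blocks by simp
  obtain x where x: "x \<in> carrier_vec (d + d)" "\<And>i. i < d + d \<Longrightarrow> x $ i > 0"
      "\<And>i. i < d + d \<Longrightarrow> (?H *\<^sub>v x) $ i > 0"
    using M_matrix_positive_vector[OF Hc M] by blast
  have N: "?N $$ (i, j) \<ge> 0" if i: "i < d + d" and j: "j < d + d" for i j
  proof -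
    \<comment> \<open>\<open>?H\<close> maps column \<open>j\<close> of its inverse to a unit
      vector, which is nonnegative, so monotonicity applies to the column.\<close>
    have "col ?N j $ i \<ge> 0"
    proof (rule Z_matrix_monotone[OF Hc x(1) _ Z x(2,3) _ i])
      show "col ?N j \<in> carrier_vec (d + d)" using Nc j by auto
      have "?H *\<^sub>v col ?N j = col (?H * ?N) j" by (rule col_mult2[OF Hc Nc j, symmetric])
      also have "?H * ?N = 1\<^sub>m (d + d)" by (rule symplectic_right_inverse[OF blocks symp])
      finally show "(?H *\<^sub>v col ?N j) $ k \<ge> 0" if "k < d + d" for k
        using that j by simp
    qed
    then show ?thesis using i j Nc by (simp del: index_mat_four_block)
  qed
  \<comment> \<open>The transposed block sits at the lower right of \<open>?N\<close>, so the entry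
    \<open>(i, j)\<close> of \<open>A\<close> is found at \<open>(d + j, d + i)\<close>.\<close>
  have nonneg: "A $$ (i, j) \<ge> 0" if "i < d" "j < d" for i j
    using N[of "d + j" "d + i"] that blocks by simp
  show "A $$ (i, j) = 0" if "i < d" "j < d" "i \<noteq> j" for i j
    using nonneg[of i j] offdiag[of i j] that by simp
  show "A $$ (i, i) > 0" if i: "i < d" for i
  proof (rule ccontr)
    \<comment> \<open>A nonpositive diagonal entry would make all of row \<open>i\<close> of
      \<open>?H\<close> nonpositive, and its product with the positive \<open>x\<close> could not be
      positive.\<close>
    assume neg: "\<not> A $$ (i, i) > 0"
    have "(?H *\<^sub>v x) $ i = (\<Sum>j = 0..<d + d. ?H $$ (i, j) * x $ j)"
      using i by (intro mult_mat_vec_index_sum[OF Hc x(1)]) simp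
    also have "\<dots> \<le> 0"
    proof (rule sum_nonpos)
      fix j assume "j \<in> {0..<d + d}"
      then have "?H $$ (i, j) \<le> 0" "x $ j \<ge> 0"
        using Z[of i j] neg i blocks x(2)[of j] by (cases "i = j"; simp)+
      then show "?H $$ (i, j) * x $ j \<le> 0" by (rule mult_nonpos_nonneg)
    qed
    finally show False using x(3)[of i] i by simp
  qed
qed

lemma SPM_factorization:
  assumes H: "H \<in> SPM d"
  obtains S1 S2 S3 S4 where "S1 \<in> sym_mats d" "S2 \<in> sym_mats d" "S3 \<in> sym_mats d" "S4 \<in> sym_mats d"
    "H = lower_unit d S4 * (upper_unit d S3 * (lower_unit d S2 * upper_unit d S1))"
proof -
  obtain A B C D where split: "split_block H d d = (A, B, C, D)" by (metis prod_cases4)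
  have "dim_row H = d + d" "dim_col H = d + d" using H by (auto simp: SPM_def symplectic_def)
  note sb = split_block[OF split this]
  note blocks = sb(1-4)
  have H': "four_block_mat A B C D \<in> SPM d" using H sb(5) by simp
  note A = SPM_upper_left_block[OF blocks H']
  \<comment> \<open>Since \<open>A\<close> is diagonal with positive diagonal, the reciprocals of
    its diagonal entries give the inverse.\<close>
  define K where "K = mat d d (\<lambda>(i, j). if i = j then 1 / A $$ (i, i) else 0)"
  have K: "K \<in> carrier_mat d d" by (simp add: K_def)
  have AK: "A * K = 1\<^sub>m d"
  proof (rule eq_matI)
    fix i j assume "i < dim_row (1\<^sub>m d :: real mat)" "j < dim_col (1\<^sub>m d :: real mat)"
    then have ij: "i < d" "j < d" by simp_all
    have "(A * K) $$ (i, j) = (\<Sum>k = 0..<d. A $$ (i, k) * (if k = j then 1 / A $$ (k, k) else 0))"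
      using ij blocks(1) by (simp add: K_def scalar_prod_def)
    also have "\<dots> = (\<Sum>k = 0..<d. if k = j then A $$ (i, j) / A $$ (j, j) else 0)"
      by (rule sum.cong) auto
    also have "\<dots> = (1\<^sub>m d :: real mat) $$ (i, j)"
      using ij A(1)[OF ij(2)] A(2)[OF ij] by (cases "i = j") auto
    finally show "(A * K) $$ (i, j) = 1\<^sub>m d $$ (i, j)" .
  qed (use blocks K in auto)
  have AT: "A\<^sup>T = A"
  proof (rule eq_matI)
    show "A\<^sup>T $$ (i, j) = A $$ (i, j)" if "i < dim_row A" "j < dim_col A" for i j
      using that blocks(1) A(2)[of i j] A(2)[of j i] by (cases "i = j") auto
  qed (use blocks in auto)
  have "symplectic d (four_block_mat A B C D)" using H' by (simp add: SPM_def)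
  from symplectic_factorization[OF blocks this K AK AT, folded sb(5)] that show thesis by blast
qed

section \<open>Inclusion, factor list and properness\<close>

lemma unit_carrier [simp]:
  assumes "S \<in> carrier_mat d d"
  shows "upper_unit d S \<in> carrier_mat (2 * d) (2 * d)" "lower_unit d S \<in> carrier_mat (2 * d) (2 * d)"
  using assms by (simp_all add: upper_unit_def lower_unit_def mult_2)

theorem theorem12:
  fixes d :: nat
  assumes "d \<ge> 1"
  shows "SPM d \<subset> L_set d 4 \<and>
    (\<forall>H \<in> SPM d. \<exists>Ms. length Ms \<le> 4 \<and> set Ms \<subseteq> unit_triangular_symplectic d \<and>
       H = foldr (*) Ms (1\<^sub>m (2 * d)))"
proof (intro conjI psubsetI ballI subsetI)
  have alt_prod: "alt_prod d S 4 = lower_unit d (S 4) * (upper_unit d (S 3) * (lower_unit d (S 2) * upper_unit d (S 1)))"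
    if "S 1 \<in> sym_mats d" for S
  proof -
    have "alt_prod d S 4 = alt_factor d S 4 * (alt_factor d S 3 * (alt_factor d S 2 * (alt_factor d S 1 * 1\<^sub>m (2 * d))))"
      by (simp add: eval_nat_numeral)
    also have "alt_factor d S 1 * 1\<^sub>m (2 * d) = upper_unit d (S 1)"
      using that by (simp add: alt_factor_def sym_mats_def right_mult_one_mat[of _ "2 * d" "2 * d"])
    finally show ?thesis by (simp add: alt_factor_def)
  qed
  {
    fix H assume "H \<in> SPM d"
    then obtain S1 S2 S3 S4 where S: "S1 \<in> sym_mats d" "S2 \<in> sym_mats d" "S3 \<in> sym_mats d" "S4 \<in> sym_mats d"
      and H: "H = lower_unit d S4 * (upper_unit d S3 * (lower_unit d S2 * upper_unit d S1))"
      by (rule SPM_factorization)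
    define S where "S i = (if i = 1 then S1 else if i = 2 then S2 else if i = 3 then S3 else S4)" for i :: nat
    have "H = alt_prod d S 4" using S H by (subst alt_prod) (simp_all add: S_def)
    moreover have "\<forall>i\<in>{1..4}. S i \<in> sym_mats d" using S by (simp add: S_def)
    ultimately show "H \<in> L_set d 4" by (auto simp: L_set_def)
    \<comment> \<open>The list follows the product from left to right, so the factor with the
      highest index comes first.\<close>
    let ?Ms = "[lower_unit d S4, upper_unit d S3, lower_unit d S2, upper_unit d S1]"
    have "H = foldr (*) ?Ms (1\<^sub>m (2 * d))"
      using S H by (simp add: sym_mats_def right_mult_one_mat[of _ "2 * d" "2 * d"])
    moreover have "length ?Ms \<le> 4 \<and> set ?Ms \<subseteq> unit_triangular_symplectic d"
      using S by (auto simp: unit_triangular_symplectic_def)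
    ultimately show "\<exists>Ms. length Ms \<le> 4 \<and> set Ms \<subseteq> unit_triangular_symplectic d \<and> H = foldr (*) Ms (1\<^sub>m (2 * d))"
      by blast
  }
  \<comment> \<open>Witness for properness: with all factors but the first trivial, the product is
    \<open>upper_unit d (1\<^sub>m d)\<close>. Its off-diagonal entry at \<open>(0, d)\<close> is 1,
    which no M-matrix allows; \<open>d \<ge> 1\<close> puts this index in range.\<close>
  define S :: "nat \<Rightarrow> real mat" where "S i = (if i = 1 then 1\<^sub>m d else 0\<^sub>m d d)" for i
  have S: "S i \<in> sym_mats d" for i by (simp add: S_def sym_mats_def)
  have one: "lower_unit d (0\<^sub>m d d) = 1\<^sub>m (d + d)" "upper_unit d (0\<^sub>m d d) = 1\<^sub>m (d + d)"
    by (simp_all add: lower_unit_def upper_unit_def)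
  have U: "upper_unit d (1\<^sub>m d) \<in> carrier_mat (d + d) (d + d)" by (simp add: upper_unit_def)
  have "alt_prod d S 4 = upper_unit d (1\<^sub>m d)"
    using U by (subst alt_prod[of S, OF S]) (simp add: S_def one)
  then have "upper_unit d (1\<^sub>m d) \<in> L_set d 4" using S by (auto simp: L_set_def intro!: exI[of _ S])
  moreover have "upper_unit d (1\<^sub>m d) \<notin> SPM d"
  proof
    assume "upper_unit d (1\<^sub>m d) \<in> SPM d"
    then have "upper_unit d (1\<^sub>m d) $$ (0, d) \<le> 0"
      using assms carrier_matD[OF U] unfolding SPM_def M_matrix_def by simp
    then show False using assms by (simp add: upper_unit_def)
  qed
  ultimately show "SPM d \<noteq> L_set d 4" by blast
qed

end
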